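(* The following hold for the lamplighter group $L_2$: (a) $[L_2,L_2]=\ker(\sigma_a)\cap\ker(\sigma_t)$. (b) The commutator width of $L_2$ is one.
   Context: Let $\mathbb{Z}_2^{\mathbb{Z}}$ denote the abelian group of finitely supported functions $f:\mathbb{Z}\to\mathbb{Z}_2$ under pointwise addition, and for $b\in\mathbb{Z}$ put $f^b(x)=f(x+b)$. The lamplighter group is $L_2=\mathbb{Z}\ltimes\mathbb{Z}_2^{\mathbb{Z}}$, the set of pairs $(\delta,f)$ with product $(\delta_1,f_1)(\delta_2,f_2)=(\delta_1+\delta_2,\,f_1^{\delta_2}+f_2)$. The homomorphisms $\sigma_a:L_2\to\mathbb{Z}_2$ and $\sigma_t:L_2\to\mathbb{Z}$ are defined by $\sigma_a(\delta,f)=\sum_{i\in\mathbb{Z}}f(i)$ and $\sigma_t(\delta,f)=\delta$. The commutator width of a group $G$ is the least $k\in\mathbb{N}\cup\{\infty\}$ such that every $g\in[G,G]$ is a product of at most $k$ commutators. *)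

theory Defs
  imports
    "HOL-Algebra.Elementary_Groups"
    "HOL-Algebra.Generated_Groups"
    "HOL-Library.Extended_Nat"
    "HOL-Library.Poly_Mapping"
    "HOL-Library.Z2"
begin

definition bit_group :: "bit monoid"
  where "bit_group = \<lparr>carrier = UNIV, monoid.mult = (+), one = 0\<rparr>"

text \<open>Finitely supported functions from the integers to the field \<^typ>\<open>bit\<close> are rendered by
  the library type of finitely supported maps. The translate by \<open>b\<close> is \<open>f\<^sup>b(x) = f(x + b)\<close>.\<close>

definition shift :: "int \<Rightarrow> (int \<Rightarrow>\<^sub>0 bit) \<Rightarrow> (int \<Rightarrow>\<^sub>0 bit)"
  where "shift b f = Poly_Mapping.map_key (\<lambda>x. x + b) f"

lemma lookup_shift: "Poly_Mapping.lookup (shift b f) x = Poly_Mapping.lookup f (x + b)"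
  by (simp add: shift_def map_key.rep_eq)

definition lamplighter :: "(int \<times> (int \<Rightarrow>\<^sub>0 bit)) monoid"  (\<open>L\<^sub>2\<close>)
  where "L\<^sub>2 = \<lparr>carrier = UNIV,
    monoid.mult = (\<lambda>(d1, f1) (d2, f2). (d1 + d2, shift d2 f1 + f2)),
    one = (0, 0)\<rparr>"

definition sigma_a :: "int \<times> (int \<Rightarrow>\<^sub>0 bit) \<Rightarrow> bit"
  where "sigma_a g = Sum_any (Poly_Mapping.lookup (snd g))"

definition sigma_t :: "int \<times> (int \<Rightarrow>\<^sub>0 bit) \<Rightarrow> int"
  where "sigma_t g = fst g"

text \<open>The set \<open>derived_set G (carrier G)\<close> is the set of all commutators of \<open>G\<close>. For
  \<open>k = \<infinity>\<close> the bound on the length is void, so the minimum is over a nonempty set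
  whenever \<open>G\<close> is a group.\<close>

definition commutator_width :: "('a, 'b) monoid_scheme \<Rightarrow> enat"
  where "commutator_width G = (LEAST k. \<forall>g \<in> derived G (carrier G).
    \<exists>cs. set cs \<subseteq> derived_set G (carrier G) \<and> enat (length cs) \<le> k \<and>
         g = foldr (\<otimes>\<^bsub>G\<^esub>) cs \<one>\<^bsub>G\<^esub>)"

lemma group_bit_group: "group bit_group"
proof (rule groupI)
  fix x assume "x \<in> carrier bit_group"
  show "\<exists>y\<in>carrier bit_group. y \<otimes>\<^bsub>bit_group\<^esub> x = \<one>\<^bsub>bit_group\<^esub>"
    by (intro bexI[of _ x]) (simp_all add: bit_group_def)
qed (simp_all only: bit_group_def partial_object.simps monoid.simps UNIV_I add.assoc add_0_left)

lemma group_lamplighter: "group L\<^sub>2"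
proof (rule groupI)
  fix x y z :: "int \<times> (int \<Rightarrow>\<^sub>0 bit)"
  show "x \<otimes>\<^bsub>L\<^sub>2\<^esub> y \<otimes>\<^bsub>L\<^sub>2\<^esub> z = x \<otimes>\<^bsub>L\<^sub>2\<^esub> (y \<otimes>\<^bsub>L\<^sub>2\<^esub> z)"
    by (cases x; cases y; cases z)
      (auto simp: lamplighter_def lookup_add lookup_shift algebra_simps intro!: poly_mapping_eqI)
  show "\<one>\<^bsub>L\<^sub>2\<^esub> \<otimes>\<^bsub>L\<^sub>2\<^esub> x = x"
    by (cases x) (auto simp: lamplighter_def lookup_add lookup_shift intro!: poly_mapping_eqI)
  show "\<exists>y\<in>carrier L\<^sub>2. y \<otimes>\<^bsub>L\<^sub>2\<^esub> x = \<one>\<^bsub>L\<^sub>2\<^esub>"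
    by (intro bexI[of _ "(- fst x, shift (- fst x) (snd x))"])
      (auto simp: lamplighter_def lookup_add lookup_shift case_prod_beta intro!: poly_mapping_eqI)
qed (simp_all add: lamplighter_def)

lemma Sum_any_lookup_add:
  fixes f g :: "int \<Rightarrow>\<^sub>0 bit"
  shows "Sum_any (Poly_Mapping.lookup (f + g)) =
    Sum_any (Poly_Mapping.lookup f) + Sum_any (Poly_Mapping.lookup g)"
proof -
  have "Poly_Mapping.lookup (f + g) = (\<lambda>x. Poly_Mapping.lookup f x + Poly_Mapping.lookup g x)"
    by (simp only: lookup_add fun_eq_iff simp_thms)
  then show ?thesis
    by (simp only: Sum_any.distrib[OF finite_lookup finite_lookup])
qed

lemma Sum_any_lookup_shift:
  "Sum_any (Poly_Mapping.lookup (shift b f)) = Sum_any (Poly_Mapping.lookup f)"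
proof (rule Sum_any.reindex_cong[symmetric])
  show "bij (\<lambda>x::int. x + b)"
    by (rule o_bij[of "\<lambda>x. x - b"]) auto
  show "Poly_Mapping.lookup f \<circ> (\<lambda>x. x + b) = Poly_Mapping.lookup (shift b f)"
    by (simp add: lookup_shift fun_eq_iff)
qed

lemma sigma_a_hom: "sigma_a \<in> hom L\<^sub>2 bit_group"
  by (rule homI)
    (auto simp: sigma_a_def lamplighter_def bit_group_def Sum_any_lookup_add Sum_any_lookup_shift)

lemma sigma_t_hom: "sigma_t \<in> hom L\<^sub>2 integer_group"
  by (rule homI) (auto simp: sigma_t_def lamplighter_def integer_group_def)

end

theory Submission
  imports Defs
begin

text \<open>The commutator of \<open>(1, 0)\<close> and \<open>(0, g)\<close> is \<open>(0, g\<^sup>-\<^sup>1 + g)\<close>, where \<open>g\<^sup>-\<^sup>1\<close> is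
  the translate of \<open>g\<close> by \<open>-1\<close>. If the values of \<open>f\<close> sum to zero, then the tail sums
  \<open>g(x) = \<Sum>i>x. f(i)\<close> have finite support and telescope to \<open>f = g\<^sup>-\<^sup>1 + g\<close>. So every element of
  the two kernels is a single commutator; the converse holds because the targets are abelian.\<close>

text \<open>A homomorphism carries the derived subgroup onto the derived subgroup of its image, and
  that is trivial inside an abelian group.\<close>

lemma (in group_hom) derived_subset_kernel:
  assumes "comm_group H"
  shows "derived G (carrier G) \<subseteq> kernel G H h"
proof -
  have "h ` derived G (carrier G) = {\<one>\<^bsub>H\<^esub>}"
    using derived_img[of "carrier G"] comm_group.derived_eq_singleton[OF assms, of "h ` carrier G"]
      hom_carrier[OF homh]
    by simp
  then show ?thesis
    using G.derived_in_carrier[of "carrier G"] by (auto simp: kernel_def)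
qed

lemma comm_group_bit_group: "comm_group bit_group"
  by (rule group.group_comm_groupI[OF group_bit_group]) (simp only: bit_group_def monoid.simps add.commute)

lemma mult_lamplighter: "(d1, f1) \<otimes>\<^bsub>L\<^sub>2\<^esub> (d2, f2) = (d1 + d2, shift d2 f1 + f2)"
  by (simp add: lamplighter_def)

lemma carrier_lamplighter: "carrier L\<^sub>2 = UNIV"
  by (simp add: lamplighter_def)

lemma one_lamplighter: "\<one>\<^bsub>L\<^sub>2\<^esub> = (0, 0)"
  by (simp add: lamplighter_def)

lemma shift_0: "shift 0 f = f"
  by (rule poly_mapping_eqI) (simp add: lookup_shift)

lemma shift_zero: "shift b 0 = 0"
  by (rule poly_mapping_eqI) (simp add: lookup_shift)

lemma bit_poly_mapping_double: "f + f = 0" for f :: "'a \<Rightarrow>\<^sub>0 bit"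
  by (rule poly_mapping_eqI) (simp add: lookup_add)

text \<open>Conjugating \<open>(0, g)\<close> by \<open>(1, 0)\<close> translates \<open>g\<close>
  by -1; since the lamps have characteristic two, \<open>(0, g)\<close> is its own inverse and no
  sign appears.\<close>

lemma commutator_lamplighter:
  "(1, 0) \<otimes>\<^bsub>L\<^sub>2\<^esub> (0, g) \<otimes>\<^bsub>L\<^sub>2\<^esub> inv\<^bsub>L\<^sub>2\<^esub> (1, 0) \<otimes>\<^bsub>L\<^sub>2\<^esub> inv\<^bsub>L\<^sub>2\<^esub> (0, g) = (0, shift (- 1) g + g)"
proof -
  interpret group "L\<^sub>2"
    by (rule group_lamplighter)
  have "inv\<^bsub>L\<^sub>2\<^esub> (1, 0) = (- 1, 0)"
    by (rule inv_equality) (simp_all add: mult_lamplighter carrier_lamplighter one_lamplighter shift_zero)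
  moreover have "inv\<^bsub>L\<^sub>2\<^esub> (0, g) = (0, g)"
    by (rule inv_equality)
      (simp_all add: mult_lamplighter carrier_lamplighter one_lamplighter shift_0 bit_poly_mapping_double)
  ultimately show ?thesis
    by (simp add: mult_lamplighter shift_0 shift_zero)
qed

lemma ex_shift_add_eq:
  fixes f :: "int \<Rightarrow>\<^sub>0 bit"
  assumes "Sum_any (Poly_Mapping.lookup f) = 0"
  obtains g where "f = shift (- 1) g + g"
proof -
  let ?K = "Poly_Mapping.keys f"
  define G where "G x = (\<Sum>i\<in>{i\<in>?K. i > x}. Poly_Mapping.lookup f i)" for x
  have total: "(\<Sum>i\<in>?K. Poly_Mapping.lookup f i) = 0"
    using assms by (simp add: Sum_any.expand_set keys.rep_eq)
  \<comment> \<open>To the right of all keys the sum \<open>G x\<close> is empty; to the left of all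
    keys it is the total sum, which vanishes by assumption. So a nonzero \<open>G x\<close> needs a
    key \<open>i\<close> with \<open>i \<le> x\<close> and a key \<open>j\<close> with
    \<open>j > x\<close>.\<close>
  have "{x. G x \<noteq> 0} \<subseteq> (\<Union>i\<in>?K. \<Union>j\<in>?K. {i..j})"
  proof
    fix x assume "x \<in> {x. G x \<noteq> 0}"
    then have x: "G x \<noteq> 0" by simp
    then have "{i\<in>?K. i > x} \<noteq> {}"
      unfolding G_def by (metis sum.empty)
    moreover have "{i\<in>?K. i > x} \<noteq> ?K"
      using x total unfolding G_def by metis
    ultimately show "x \<in> (\<Union>i\<in>?K. \<Union>j\<in>?K. {i..j})"
      by force
  qed
  then have fin: "finite {x. G x \<noteq> 0}"
    by (rule finite_subset) simp
  have step: "G (x - 1) = Poly_Mapping.lookup f x + G x" for x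
  proof (cases "x \<in> ?K")
    case True
    then have "{i\<in>?K. i > x - 1} = insert x {i\<in>?K. i > x}" by force
    then show ?thesis unfolding G_def by simp
  next
    case False
    then have "{i\<in>?K. i > x - 1} = {i\<in>?K. i > x}"
      by (metis (lifting) order_le_less zle_diff1_eq not_less)
    then show ?thesis unfolding G_def using False by (simp add: in_keys_iff)
  qed
  have lookup_G: "Poly_Mapping.lookup (Abs_poly_mapping G) = G"
    by (rule lookup_Abs_poly_mapping[OF fin])
  have "f = shift (- 1) (Abs_poly_mapping G) + Abs_poly_mapping G"
  proof (rule poly_mapping_eqI)
    fix x
    \<comment> \<open>By \<open>step\<close> the right side is the value of \<open>f\<close> at
      \<open>x\<close> plus twice \<open>G x\<close>, and doubling vanishes in
      \<open>bit\<close>.\<close>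
    have "Poly_Mapping.lookup f x = G (x - 1) + G x"
      unfolding step by (cases "Poly_Mapping.lookup f x"; cases "G x") simp_all
    then show "Poly_Mapping.lookup f x =
        Poly_Mapping.lookup (shift (- 1) (Abs_poly_mapping G) + Abs_poly_mapping G) x"
      by (simp add: lookup_add lookup_shift lookup_G del: add_bit_eq_xor)
  qed
  then show ?thesis by (rule that)
qed

text \<open>The inclusions form a cycle: derived subgroup, intersection of kernels, set of
  commutators, derived subgroup. Hence all three coincide. The first equality says that the
  commutators already form a subgroup, which bounds the width by one.\<close>

lemma commutators_lamplighter:
  "derived_set L\<^sub>2 (carrier L\<^sub>2) = kernel L\<^sub>2 bit_group sigma_a \<inter> kernel L\<^sub>2 integer_group sigma_t"
  and derived_lamplighter:
  "derived L\<^sub>2 (carrier L\<^sub>2) = kernel L\<^sub>2 bit_group sigma_a \<inter> kernel L\<^sub>2 integer_group sigma_t"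
proof -
  let ?N = "kernel L\<^sub>2 bit_group sigma_a \<inter> kernel L\<^sub>2 integer_group sigma_t"
  have "derived L\<^sub>2 (carrier L\<^sub>2) \<subseteq> ?N"
    using group_hom.derived_subset_kernel[OF _ comm_group_bit_group, of "L\<^sub>2" sigma_a]
      group_hom.derived_subset_kernel[OF _ abelian_integer_group, of "L\<^sub>2" sigma_t]
      group_lamplighter group_bit_group group_integer_group sigma_a_hom sigma_t_hom
    by (simp add: group_hom_def group_hom_axioms_def)
  moreover have "derived_set L\<^sub>2 (carrier L\<^sub>2) \<subseteq> derived L\<^sub>2 (carrier L\<^sub>2)"
    unfolding derived_def by (blast intro: generate.incl)
  moreover have "?N \<subseteq> derived_set L\<^sub>2 (carrier L\<^sub>2)"
  proof
    fix x assume "x \<in> ?N"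
    then obtain f where x: "x = (0, f)" and "Sum_any (Poly_Mapping.lookup f) = 0"
      by (cases x) (auto simp: kernel_def sigma_a_def sigma_t_def bit_group_def)
    then obtain g where "f = shift (- 1) g + g"
      using ex_shift_add_eq by blast
    then show "x \<in> derived_set L\<^sub>2 (carrier L\<^sub>2)"
      unfolding x carrier_lamplighter using commutator_lamplighter[of g, symmetric] by blast
  qed
  ultimately show "derived_set L\<^sub>2 (carrier L\<^sub>2) = ?N" "derived L\<^sub>2 (carrier L\<^sub>2) = ?N"
    by auto
qed

text \<open>One-element lists give the upper bound. For the lower bound, the empty list folds to the
  unit, so a nontrivial element of the derived subgroup needs a list of length at least one.\<close>

lemma commutator_width_eq_1:
  assumes "group G"
    and "derived G (carrier G) \<subseteq> derived_set G (carrier G)"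
    and "derived G (carrier G) \<noteq> {\<one>\<^bsub>G\<^esub>}"
  shows "commutator_width G = 1"
proof -
  interpret group G by fact
  have one: "\<one>\<^bsub>G\<^esub> \<in> derived G (carrier G)"
    unfolding derived_def by (rule generate.one)
  show ?thesis
    unfolding commutator_width_def
  proof (rule Least_equality)
    show "\<forall>g\<in>derived G (carrier G). \<exists>cs. set cs \<subseteq> derived_set G (carrier G) \<and>
        enat (length cs) \<le> 1 \<and> g = foldr (\<otimes>\<^bsub>G\<^esub>) cs \<one>\<^bsub>G\<^esub>"
    proof
      fix g assume "g \<in> derived G (carrier G)"
      then have "g \<in> derived_set G (carrier G)" using assms(2) by blast
      moreover from this have "g \<in> carrier G" by blast
      ultimately show "\<exists>cs. set cs \<subseteq> derived_set G (carrier G) \<and>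
          enat (length cs) \<le> 1 \<and> g = foldr (\<otimes>\<^bsub>G\<^esub>) cs \<one>\<^bsub>G\<^esub>"
        by (intro exI[of _ "[g]"]) (simp add: one_enat_def)
    qed
  next
    fix k
    assume k: "\<forall>g\<in>derived G (carrier G). \<exists>cs. set cs \<subseteq> derived_set G (carrier G) \<and>
        enat (length cs) \<le> k \<and> g = foldr (\<otimes>\<^bsub>G\<^esub>) cs \<one>\<^bsub>G\<^esub>"
    obtain g where g: "g \<in> derived G (carrier G)" "g \<noteq> \<one>\<^bsub>G\<^esub>"
      using assms(3) one by blast
    then obtain cs where cs: "enat (length cs) \<le> k" "g = foldr (\<otimes>\<^bsub>G\<^esub>) cs \<one>\<^bsub>G\<^esub>"
      using k by blast
    then have "1 \<le> length cs" using g by (cases cs) auto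
    then have "1 \<le> enat (length cs)" by (simp add: one_enat_def)
    then show "1 \<le> k" using cs(1) by (rule order_trans)
  qed
qed

theorem lemma4p1:
  shows "derived L\<^sub>2 (carrier L\<^sub>2) = kernel L\<^sub>2 bit_group sigma_a \<inter> kernel L\<^sub>2 integer_group sigma_t
    \<and> commutator_width L\<^sub>2 = 1"
proof
  show "derived L\<^sub>2 (carrier L\<^sub>2) = kernel L\<^sub>2 bit_group sigma_a \<inter> kernel L\<^sub>2 integer_group sigma_t"
    by (rule derived_lamplighter)
  \<comment> \<open>With a single lamp lit at 1, the translate is lit only at 2, so the two cannot
    cancel and the resulting commutator is not the unit.\<close>
  let ?f = "Poly_Mapping.single 1 1 :: int \<Rightarrow>\<^sub>0 bit"
  have "Poly_Mapping.lookup (shift (- 1) ?f + ?f) 1 \<noteq> 0"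
    by (simp add: lookup_add lookup_shift lookup_single)
  then have "(0, shift (- 1) ?f + ?f) \<noteq> \<one>\<^bsub>L\<^sub>2\<^esub>"
    by (metis one_lamplighter lookup_zero snd_conv)
  moreover have "(0, shift (- 1) ?f + ?f) \<in> derived_set L\<^sub>2 (carrier L\<^sub>2)"
    unfolding carrier_lamplighter using commutator_lamplighter[of ?f, symmetric] by blast
  ultimately show "commutator_width L\<^sub>2 = 1"
    by (intro commutator_width_eq_1 group_lamplighter)
      (auto simp only: commutators_lamplighter derived_lamplighter)
qed

end
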